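(* Let $(\Omega,\mu)$ be a $\sigma$-finite measure space. Let $\theta_1,\dots,\theta_d\in(0,1)$ be such that $\sum_{j=1}^d \theta_j=1$. For each $j=1,\dots,d$ let $K_j$ be an indexing set (of arbitrary cardinality) and let $\{u_{j,k_j}\}_{k_j\in K_j}$ be a saturating family of non-negative measurable functions on $\Omega$ indexed by it. Let $A\in[0,\infty)$ be a constant and assume that $$\int_\Omega \prod_{j=1}^d \left|\sum_{k_j\in K_j} \alpha_{j,k_j} u_{j,k_j}\right|^{\theta_j} \mathrm{d}\mu \leq A \prod_{j=1}^d \left( \sum_{k_j\in K_j} |\alpha_{j,k_j}|\right)^{\theta_j}$$ for all finitely supported families $\{\alpha_{j,k_j}\}_{k_j\in K_j}$ ($j=1,\dots,d$) of reals. Then there exist non-negative measurable functions $\phi_1,\dots,\phi_d$ on $\Omega$ such that $$1\leq \prod_{j=1}^d \phi_j^{\theta_j} \quad\text{$\mu$-almost everywhere}$$ and such that for each $j=1,\ldots,d$ we have $$\int_\Omega u_{j,k_j} \phi_j \,\mathrm{d}\mu \leq A \quad\text{for all } k_j\in K_j.$$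
   Context: A non-empty collection $U$ of measurable functions on $(\Omega,\mu)$ is called saturating if for every measurable set $E\subseteq\Omega$ the following implication holds: if for every $u\in U$ we have $u=0$ $\mu$-a.e. on $E$, then $\mu(E)=0$. Functions are real-valued. *)

theory Defs
  imports "HOL-Analysis.Analysis"
begin

definition saturating :: "'a measure \<Rightarrow> ('a \<Rightarrow> real) set \<Rightarrow> bool" where
  "saturating M U \<longleftrightarrow>
     U \<noteq> {} \<and> U \<subseteq> borel_measurable M \<and>
     (\<forall>E\<in>sets M. (\<forall>u\<in>U. AE x in M. x \<in> E \<longrightarrow> u x = 0) \<longrightarrow> emeasure M E = 0)"

end

theory Submission imports Defs
begin

text \<open>The factorisation inequality is dual to the hypothesis. Write \<open>gm v\<close> for the weighted geometric
mean \<open>\<Prod>j\<in>J. v j powr \<theta> j\<close>. If all the functions are positive and each family is finite, the dual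
problem is to maximise \<open>\<integral> gm (\<lambda>j. \<Sum>k. \<beta> j k * u j k)\<close> over convex weights \<open>\<beta> j\<close>. A maximiser \<open>\<beta>\<close> exists by
compactness, with value at most \<open>A\<close>. With \<open>v j = \<Sum>k. \<beta> j k * u j k\<close>, the functions \<open>\<phi> j = gm v / v j\<close>
satisfy \<open>gm \<phi> = 1\<close>, and the optimality condition obtained by moving the weight of one family towards a
single index \<open>k\<close> is exactly \<open>\<integral> u j k * \<phi> j \<le> \<integral> gm v \<le> A\<close>
(\<open>factorisation_of_finite_positive_families\<close>). Functions with zeros are first increased by a
positive function small enough to raise the bound only to \<open>A + \<epsilon>\<close>
(\<open>factorisation_of_finite_families_up_to\<close>).

So any finitely many of the constraints \<open>\<integral> u j k * \<phi> j \<le> A + 1 / Suc n\<close> can be met by some \<open>\<phi>\<close> with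
\<open>gm \<phi> \<ge> 1\<close>. The constraints are convex, but their number may be uncountable and nothing bounds the
functions \<open>\<phi> j\<close> in a space with a weak compactness. The substitution \<open>e = exp (- \<phi>)\<close> handles both
difficulties. It takes values in \<open>{0..1}\<close>, and the functional \<open>\<Sum>j\<in>J. \<integral> (exp (- \<phi> j))\<^sup>2\<close>, taken for a finite
measure with the same null sets, is strictly convex along \<open>\<phi>\<close>: its midpoint defect is half the squared
\<open>L\<^sup>2\<close> distance of the exponentials, because \<open>exp (- (a + b) / 2)\<^sup>2 = exp (- a) * exp (- b)\<close>. As in the proof
that a closed convex set in a Hilbert space has a unique element of least norm, near-minimisers over
larger and larger finite sets of constraints converge, and adding one more constraint does not
change the limit \<open>g\<close>. Hence a single \<open>g\<close> serves all constraints
(\<open>midpoint_closed_constraints_common_limit\<close>).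

Then \<open>\<phi> = - ln g\<close> inherits every integral bound from Fatou's lemma. It could take the value \<open>\<infinity>\<close> only where
\<open>g j = 0\<close>; there the bounds force every \<open>u j k\<close> to vanish, so this set is null because the family is
saturating. With finite limits, \<open>gm \<phi> \<ge> 1\<close> passes to the limit as well.\<close>

section \<open>Auxiliary facts\<close>

text \<open>This function has two uses: its density replaces a \<open>\<sigma>\<close>-finite measure by a finite one with the same
null sets, and it measures how much room a small perturbation of an integrand leaves.\<close>
lemma exists_positive_integrand_le:
  assumes "sigma_finite_measure M" and "0 < (\<epsilon>::real)"
  obtains h :: "'a \<Rightarrow> real" where "h \<in> borel_measurable M" "\<And>x. 0 < h x"
    "(\<integral>\<^sup>+x. ennreal (h x) \<partial>M) \<le> ennreal \<epsilon>"
proof -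
  obtain f where f: "f \<in> borel_measurable M" "integral\<^sup>N M f \<noteq> \<infinity>"
    "\<And>x. x \<in> space M \<Longrightarrow> 0 < f x \<and> f x < \<infinity>"
    using sigma_finite_measure.Ex_finite_integrable_function[OF assms(1)] by auto
  define I where "I = enn2real (integral\<^sup>N M f)"
  have I: "integral\<^sup>N M f = ennreal I" "0 \<le> I"
    using f(2) by (auto simp: I_def ennreal_enn2real_if)
  define h where "h x = (if x \<in> space M then \<epsilon> / (I + 1) * enn2real (f x) else 1)" for x
  have m: "h \<in> borel_measurable M"
    using f(1) by (subst measurable_cong[where g = "\<lambda>x. \<epsilon> / (I + 1) * enn2real (f x)"]) (auto simp: h_def)
  have pos: "0 < h x" for x
    using f(3)[of x] assms(2) I(2) by (auto simp: h_def enn2real_positive_iff)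
  have "(\<integral>\<^sup>+x. ennreal (h x) \<partial>M) = (\<integral>\<^sup>+x. ennreal (\<epsilon> / (I + 1)) * f x \<partial>M)"
    using f(3) assms(2) I(2)
    by (intro nn_integral_cong)
      (auto simp: h_def ennreal_mult' ennreal_enn2real_if less_top[symmetric] simp del: times_divide_eq_left)
  also have "\<dots> = ennreal (\<epsilon> / (I + 1)) * ennreal I"
    using f(1) by (simp add: nn_integral_cmult I)
  also have "\<dots> = ennreal (\<epsilon> / (I + 1) * I)"
    using assms(2) I(2) by (subst ennreal_mult) auto
  also have "\<dots> \<le> ennreal \<epsilon>"
    using assms(2) I(2) by (intro ennreal_leI) (simp add: field_simps)
  finally show thesis using that m pos by blast
qed

lemma bounded_family_convergent_subseq:
  fixes x :: "nat \<Rightarrow> 'i \<Rightarrow> real"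
  assumes "finite I" and "\<And>n i. i \<in> I \<Longrightarrow> x n i \<in> {0..1}"
  obtains r l where "strict_mono (r :: nat \<Rightarrow> nat)" "\<And>i. i \<in> I \<Longrightarrow> (\<lambda>n. x (r n) i) \<longlonglongrightarrow> l i"
proof -
  have "\<exists>r l. strict_mono (r :: nat \<Rightarrow> nat) \<and> (\<forall>i\<in>I. (\<lambda>n. x (r n) i) \<longlonglongrightarrow> l i)"
    using assms
  proof (induction I rule: finite_induct)
    case empty
    then show ?case using strict_mono_id by auto
  next
    case (insert a I)
    then obtain r l where r: "strict_mono (r :: nat \<Rightarrow> nat)" "\<forall>i\<in>I. (\<lambda>n. x (r n) i) \<longlonglongrightarrow> l i"
      by auto
    have "compact {0..1::real}" by simp
    then obtain c s where s: "strict_mono (s :: nat \<Rightarrow> nat)" "((\<lambda>n. x (r n) a) \<circ> s) \<longlonglongrightarrow> c"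
      using insert.prems seq_compactE[of "{0..1::real}" "\<lambda>n. x (r n) a"]
      by (metis compact_imp_seq_compact insertI1)
    have "\<forall>i\<in>insert a I. (\<lambda>n. x ((r \<circ> s) n) i) \<longlonglongrightarrow> (l(a := c)) i"
      using LIMSEQ_subseq_LIMSEQ[OF _ s(1)] r(2) s(2) insert.hyps by (fastforce simp: o_def)
    then show ?case using strict_mono_o[OF r(1) s(1)] by blast
  qed
  then show thesis using that by auto
qed

lemma powr_add_le:
  fixes x y t :: real
  assumes "0 \<le> x" "0 \<le> y" "0 \<le> t" "t \<le> 1"
  shows "(x + y) powr t \<le> x powr t + y powr t"
proof (cases "x + y = 0")
  case False
  define s where "s = x + y"
  have s: "0 < s" using False assms by (simp add: s_def)
  have *: "z / s \<le> (z / s) powr t" if "0 \<le> z" "z \<le> s" for z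
    using powr_mono'[of t 1 "z / s"] that s assms by (cases "z = 0") auto
  have "s powr t = (x / s + y / s) * s powr t"
    using s by (simp add: s_def flip: add_divide_distrib)
  also have "\<dots> \<le> ((x / s) powr t + (y / s) powr t) * s powr t"
    using *[of x] *[of y] assms by (intro mult_right_mono add_mono) (auto simp: s_def)
  also have "\<dots> = x powr t + y powr t"
    using s assms by (simp add: powr_divide field_simps)
  finally show ?thesis by (simp add: s_def)
qed (use assms in auto)

text \<open>The error is linear in \<open>b\<close> with a constant depending only on the bound \<open>W\<close>. The base \<open>W + 2\<close> makes the
induction close, since \<open>W ^ n + (W + 1) * (W + 2) ^ n \<le> (W + 2) ^ Suc n\<close>.\<close>
lemma prod_add_le:
  fixes a :: "'j \<Rightarrow> real"
  assumes "finite J" "\<And>j. j \<in> J \<Longrightarrow> 0 \<le> a j \<and> a j \<le> W" "0 \<le> W" "0 \<le> b" "b \<le> 1"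
  shows "(\<Prod>j\<in>J. a j + b) \<le> (\<Prod>j\<in>J. a j) + b * (W + 2) ^ card J"
  using assms(1,2)
proof (induction J rule: finite_induct)
  case empty
  then show ?case using assms by simp
next
  case (insert i J)
  let ?n = "card J"
  have p: "0 \<le> (\<Prod>j\<in>J. a j)" "(\<Prod>j\<in>J. a j) \<le> (W + 2) ^ ?n"
    using insert.prems prod_mono[of J a "\<lambda>_. W + 2"] by (force intro: prod_nonneg)+
  have "(a i + b) * (\<Prod>j\<in>J. a j + b) \<le> (a i + b) * ((\<Prod>j\<in>J. a j) + b * (W + 2) ^ ?n)"
    using insert assms by (intro mult_left_mono) auto
  also have "\<dots> = a i * (\<Prod>j\<in>J. a j) + b * (\<Prod>j\<in>J. a j) + b * ((a i + b) * (W + 2) ^ ?n)"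
    by (simp add: algebra_simps)
  also have "\<dots> \<le> a i * (\<Prod>j\<in>J. a j) + b * (W + 2) ^ ?n + b * ((W + 1) * (W + 2) ^ ?n)"
    using insert.prems assms p by (intro add_mono mult_left_mono mult_right_mono) auto
  also have "\<dots> = a i * (\<Prod>j\<in>J. a j) + b * (W + 2) ^ Suc ?n"
    by (simp add: algebra_simps)
  finally show ?case using insert.hyps by simp
qed

lemma ennreal_midpoint:
  assumes "0 \<le> a" "0 \<le> b"
  shows "ennreal (1/2) * (ennreal a + ennreal b) = ennreal ((a + b) / 2)"
proof -
  have "ennreal ((a + b) / 2) = ennreal (1/2 * (a + b))" by simp
  also have "\<dots> = ennreal (1/2) * ennreal (a + b)" using assms by (intro ennreal_mult) auto
  also have "ennreal (a + b) = ennreal a + ennreal b" using assms by (rule ennreal_plus)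
  finally show ?thesis ..
qed

section \<open>Weighted geometric means and the dual problem\<close>

locale geometric_weights =
  fixes J :: "'j set" and \<theta> :: "'j \<Rightarrow> real"
  assumes finite_J: "finite J"
    and weight_pos: "j \<in> J \<Longrightarrow> 0 < \<theta> j"
    and weights_sum: "(\<Sum>j\<in>J. \<theta> j) = 1"
begin

definition gm :: "('j \<Rightarrow> real) \<Rightarrow> real" where
  "gm v = (\<Prod>j\<in>J. v j powr \<theta> j)"

lemma J_nonempty: "J \<noteq> {}"
  using weights_sum by auto

lemma weight_le_1:
  assumes "j \<in> J"
  shows "\<theta> j \<le> 1"
proof -
  have "\<theta> j \<le> (\<Sum>i\<in>J. \<theta> i)"
    using assms finite_J by (intro member_le_sum less_imp_le weight_pos) auto
  then show ?thesis by (simp add: weights_sum)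
qed

lemma gm_cong: "(\<And>j. j \<in> J \<Longrightarrow> v j = v' j) \<Longrightarrow> gm v = gm v'"
  by (simp add: gm_def)

lemma gm_nonneg [simp]: "0 \<le> gm v"
  by (simp add: gm_def prod_nonneg)

lemma gm_pos:
  assumes "\<And>j. j \<in> J \<Longrightarrow> 0 < v j"
  shows "0 < gm v"
  unfolding gm_def
proof (rule prod_pos)
  show "0 < v j powr \<theta> j" if "j \<in> J" for j using assms[OF that] by simp
qed

lemma gm_mono: "(\<And>j. j \<in> J \<Longrightarrow> 0 \<le> v j \<and> v j \<le> v' j) \<Longrightarrow> gm v \<le> gm v'"
  unfolding gm_def using weight_pos by (intro prod_mono conjI powr_mono2) (auto intro: less_imp_le)

lemma gm_measurable [measurable (raw)]:
  "(\<And>j. j \<in> J \<Longrightarrow> v j \<in> borel_measurable M) \<Longrightarrow> (\<lambda>x. gm (\<lambda>j. v j x)) \<in> borel_measurable M"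
  unfolding gm_def by measurable

lemma tendsto_gm:
  assumes "\<And>j. j \<in> J \<Longrightarrow> (\<lambda>n. v n j) \<longlonglongrightarrow> l j" "\<And>n j. j \<in> J \<Longrightarrow> (0::real) \<le> v n j"
  shows "(\<lambda>n. gm (v n)) \<longlonglongrightarrow> gm l"
  unfolding gm_def using assms weight_pos by (intro tendsto_prod tendsto_powr') auto

lemma gm_mult:
  assumes "\<And>j. j \<in> J \<Longrightarrow> 0 \<le> v j" "\<And>j. j \<in> J \<Longrightarrow> 0 \<le> v' j"
  shows "gm (\<lambda>j. v j * v' j) = gm v * gm v'"
  unfolding gm_def using assms by (simp add: powr_mult flip: prod.distrib)

lemma gm_const: "0 \<le> c \<Longrightarrow> gm (\<lambda>_. c) = c"
  using J_nonempty finite_J weight_pos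
  by (cases "c = 0") (auto simp: gm_def weights_sum powr_sum[symmetric])

text \<open>This is where the weights must sum to one: \<open>gm\<close> is then homogeneous of degree one, which turns the
optimal combination \<open>v\<close> into an admissible tuple \<open>gm v / v\<close>.\<close>
lemma gm_divide_self:
  assumes "\<And>j. j \<in> J \<Longrightarrow> 0 < v j"
  shows "gm (\<lambda>j. gm v / v j) = 1"
proof -
  have "gm v = gm (\<lambda>_. gm v)" by (simp add: gm_const)
  also have "\<dots> = gm (\<lambda>j. (gm v / v j) * v j)"
  proof (rule gm_cong)
    show "gm v = gm v / v j * v j" if "j \<in> J" for j using assms[OF that] by simp
  qed
  also have "\<dots> = gm (\<lambda>j. gm v / v j) * gm v"
    using assms by (intro gm_mult) (auto intro: less_imp_le divide_nonneg_pos)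
  finally show ?thesis using gm_pos[of v] assms by simp
qed

lemma gm_fun_upd:
  assumes "j \<in> J" "0 < v j" "0 \<le> y"
  shows "gm (v(j := y)) = gm v * (y / v j) powr \<theta> j"
proof -
  have "gm (v(j := y)) = y powr \<theta> j * (\<Prod>i\<in>J - {j}. v i powr \<theta> i)"
    unfolding gm_def using assms finite_J by (simp add: prod.remove[of J j])
  moreover have "gm v = v j powr \<theta> j * (\<Prod>i\<in>J - {j}. v i powr \<theta> i)"
    unfolding gm_def using assms finite_J by (simp add: prod.remove[of J j])
  ultimately show ?thesis using assms by (simp add: powr_divide)
qed

text \<open>The set where \<open>gm \<ge> 1\<close> is convex because of the inequality
\<open>v * v' \<le> ((v + v') / 2)\<^sup>2\<close> in each coordinate
and the multiplicativity of \<open>gm\<close>.\<close>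
lemma gm_midpoint_ge_1:
  assumes "\<And>j. j \<in> J \<Longrightarrow> 0 \<le> v j" "\<And>j. j \<in> J \<Longrightarrow> 0 \<le> v' j" "1 \<le> gm v" "1 \<le> gm v'"
  shows "1 \<le> gm (\<lambda>j. (v j + v' j) / 2)"
proof -
  have *: "y * z \<le> (y + z) / 2 * ((y + z) / 2)" for y z :: real
    using zero_le_power2[of "y - z"] by (simp add: power2_eq_square field_simps)
  have "1 \<le> gm v * gm v'"
    using mult_mono[OF assms(3,4)] by simp
  also have "\<dots> = gm (\<lambda>j. v j * v' j)"
    using assms by (simp add: gm_mult)
  also have "\<dots> \<le> gm (\<lambda>j. ((v j + v' j) / 2) * ((v j + v' j) / 2))"
    using assms * by (intro gm_mono) auto
  also have "\<dots> = gm (\<lambda>j. (v j + v' j) / 2) ^ 2"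
    unfolding power2_eq_square using assms by (intro gm_mult) auto
  finally have "1\<^sup>2 \<le> gm (\<lambda>j. (v j + v' j) / 2) ^ 2" by simp
  then show ?thesis using power2_le_imp_le[OF _ gm_nonneg] by blast
qed

text \<open>A product of simplices, one for each index \<open>j\<close>. Values off \<open>J\<close> and off the sets \<open>F j\<close> are left
unconstrained, so that a weight system can be updated with no regard to them.\<close>
definition weight_systems :: "('j \<Rightarrow> 'k set) \<Rightarrow> ('j \<Rightarrow> 'k \<Rightarrow> real) set" where
  "weight_systems F = {\<beta>. \<forall>j\<in>J. (\<forall>k\<in>F j. 0 \<le> \<beta> j k) \<and> (\<Sum>k\<in>F j. \<beta> j k) = 1}"

lemma weight_systems_le_1:
  assumes "\<beta> \<in> weight_systems F" "j \<in> J" "finite (F j)" "k \<in> F j"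
  shows "\<beta> j k \<le> 1"
  using assms member_le_sum[of k "F j" "\<beta> j"] by (auto simp: weight_systems_def)

lemma combination_pos:
  assumes "\<beta> \<in> weight_systems F" "j \<in> J" "finite (F j)" "\<And>k. k \<in> F j \<Longrightarrow> 0 < w k"
  shows "0 < (\<Sum>k\<in>F j. \<beta> j k * w k)"
proof -
  have "\<exists>k\<in>F j. \<beta> j k \<noteq> 0"
    using assms(1,2) by (force simp: weight_systems_def dest!: bspec[of J _ j] intro: ccontr)
  then show ?thesis
    using assms by (fastforce simp: weight_systems_def intro!: sum_pos2 mult_pos_pos)
qed

text \<open>Moving a fraction \<open>t\<close> of the weight to an index whose function is \<open>\<rho>\<close> times the present combination
multiplies that combination by \<open>1 - t + t * \<rho>\<close>; this is the resulting first-order change of its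
power. The case \<open>\<rho> = 0\<close> gives the change due to the loss of weight alone.\<close>
lemma first_variation_quotient:
  fixes t :: "nat \<Rightarrow> real" and \<rho> s :: real
  assumes "t \<longlonglongrightarrow> 0" "\<And>n. t n \<noteq> 0"
  shows "(\<lambda>n. ((1 - t n + t n * \<rho>) powr s - 1) / t n) \<longlonglongrightarrow> s * (\<rho> - 1)"
proof -
  have "((\<lambda>t. (1 - t + t * \<rho>) powr s) has_real_derivative s * (\<rho> - 1)) (at 0)"
    by (auto intro!: derivative_eq_intros simp: algebra_simps)
  then have "(\<lambda>h. ((1 - h + h * \<rho>) powr s - 1) / h) \<midarrow>0\<rightarrow> s * (\<rho> - 1)"
    using DERIV_D by fastforce
  moreover have "filterlim t (at 0) sequentially"
    using assms by (simp add: filterlim_at)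
  ultimately show ?thesis by (rule filterlim_compose)
qed

text \<open>Dominated convergence makes the integral continuous on the simplices, which are sequentially
compact in the finitely many relevant coordinates.\<close>
lemma weight_systems_attain_max:
  fixes F :: "'j \<Rightarrow> 'k set" and w :: "'j \<Rightarrow> 'k \<Rightarrow> 'a \<Rightarrow> real" and B :: real
  assumes F: "\<And>j. j \<in> J \<Longrightarrow> finite (F j) \<and> F j \<noteq> {}"
    and meas: "\<And>j k. j \<in> J \<Longrightarrow> k \<in> F j \<Longrightarrow> w j k \<in> borel_measurable M"
    and nonneg: "\<And>j k x. j \<in> J \<Longrightarrow> k \<in> F j \<Longrightarrow> x \<in> space M \<Longrightarrow> 0 \<le> w j k x"
    and "0 \<le> B"
    and bound: "\<And>\<beta>. \<beta> \<in> weight_systems F \<Longrightarrow>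
       (\<integral>\<^sup>+x. ennreal (gm (\<lambda>j. \<Sum>k\<in>F j. \<beta> j k * w j k x)) \<partial>M) \<le> ennreal B"
  defines "G \<equiv> \<lambda>\<beta>. \<integral>x. gm (\<lambda>j. \<Sum>k\<in>F j. \<beta> j k * w j k x) \<partial>M"
  obtains \<beta> where "\<beta> \<in> weight_systems F" "\<And>\<beta>'. \<beta>' \<in> weight_systems F \<Longrightarrow> G \<beta>' \<le> G \<beta>"
    "\<And>\<beta>'. \<beta>' \<in> weight_systems F \<Longrightarrow> integrable M (\<lambda>x. gm (\<lambda>j. \<Sum>k\<in>F j. \<beta>' j k * w j k x))"
    "G \<beta> \<le> B"
proof -
  define V where "V \<beta> x = gm (\<lambda>j. \<Sum>k\<in>F j. \<beta> j k * w j k x)" for \<beta> x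
  have V_meas: "V \<beta> \<in> borel_measurable M" for \<beta>
    unfolding V_def using meas F by (intro gm_measurable borel_measurable_sum) auto
  have V_nonneg: "0 \<le> V \<beta> x" for \<beta> x by (simp add: V_def)
  have int: "integrable M (V \<beta>)" if "\<beta> \<in> weight_systems F" for \<beta>
    using bound[OF that] V_meas V_nonneg
    by (intro integrableI_nonneg) (auto simp: V_def intro: le_less_trans)
  have G_le: "G \<beta> \<le> B" if "\<beta> \<in> weight_systems F" for \<beta>
  proof -
    have "ennreal (G \<beta>) = (\<integral>\<^sup>+x. ennreal (V \<beta> x) \<partial>M)"
      unfolding G_def V_def[symmetric] using int[OF that] V_nonneg by (simp add: nn_integral_eq_integral)
    also have "\<dots> \<le> ennreal B" using bound[OF that] by (simp add: V_def)
    finally show ?thesis using \<open>0 \<le> B\<close> by (simp add: ennreal_le_iff)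
  qed
  \<comment> \<open>The integrand for any weights is dominated by the one with all weights equal to 1, which is a
    multiple of the one for the uniform weights and hence integrable.\<close>
  define \<beta>0 where "\<beta>0 j k = 1 / real (card (F j))" for j and k :: 'k
  have \<beta>0: "\<beta>0 \<in> weight_systems F"
    using F by (auto simp: weight_systems_def \<beta>0_def)
  define D where "D x = gm (\<lambda>j. \<Sum>k\<in>F j. w j k x)" for x
  have "D x = gm (\<lambda>j. real (card (F j))) * V \<beta>0 x" if "x \<in> space M" for x
  proof -
    have "D x = gm (\<lambda>j. real (card (F j)) * (\<Sum>k\<in>F j. \<beta>0 j k * w j k x))"
      unfolding D_def using F by (intro gm_cong) (auto simp: \<beta>0_def simp flip: sum_divide_distrib)
    also have "\<dots> = gm (\<lambda>j. real (card (F j))) * V \<beta>0 x"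
      unfolding V_def using nonneg that by (intro gm_mult) (auto intro!: sum_nonneg simp: \<beta>0_def)
    finally show ?thesis .
  qed
  then have D_int: "integrable M D"
    using int[OF \<beta>0] by (simp cong: Bochner_Integration.integrable_cong)
  have V_le_D: "V \<beta> x \<le> D x" if "\<beta> \<in> weight_systems F" "x \<in> space M" for \<beta> x
    unfolding V_def D_def using that nonneg weight_systems_le_1[OF that(1)] F
    by (intro gm_mono conjI sum_nonneg sum_mono mult_nonneg_nonneg mult_left_le_one_le)
       (auto simp: weight_systems_def)
  define s where "s = Sup (G ` weight_systems F)"
  have bdd: "bdd_above (G ` weight_systems F)" using G_le by (rule bdd_aboveI2)
  have "\<exists>\<beta>\<in>weight_systems F. s - 1 / Suc n < G \<beta>" for n
  proof -
    have "s - 1 / Suc n < s" by simp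
    then show ?thesis
      unfolding s_def using less_cSupD[of "G ` weight_systems F"] \<beta>0 by blast
  qed
  then obtain b where b: "\<And>n. b n \<in> weight_systems F" "\<And>n. s - 1 / Suc n < G (b n)" by metis
  have "finite (Sigma J F)" using finite_J F by auto
  moreover have "case_prod (b n) i \<in> {0..1}" if "i \<in> Sigma J F" for n i
    using that b(1)[of n] weight_systems_le_1[OF b(1)] F by (auto simp: weight_systems_def)
  ultimately obtain r l where r: "strict_mono (r :: nat \<Rightarrow> nat)"
    and l: "\<And>i. i \<in> Sigma J F \<Longrightarrow> (\<lambda>n. case_prod (b (r n)) i) \<longlonglongrightarrow> l i"
    using bounded_family_convergent_subseq[of "Sigma J F" "\<lambda>n. case_prod (b n)"] by blast
  define \<beta> where "\<beta> j k = l (j, k)" for j k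
  have lim: "(\<lambda>n. b (r n) j k) \<longlonglongrightarrow> \<beta> j k" if "j \<in> J" "k \<in> F j" for j k
    using l[of "(j, k)"] that by (simp add: \<beta>_def)
  have "0 \<le> \<beta> j k" if "j \<in> J" "k \<in> F j" for j k
    using LIMSEQ_le_const[OF lim[OF that]] that b(1) by (auto simp: weight_systems_def)
  moreover have "(\<Sum>k\<in>F j. \<beta> j k) = 1" if "j \<in> J" for j
  proof -
    have "(\<lambda>n. \<Sum>k\<in>F j. b (r n) j k) \<longlonglongrightarrow> (\<Sum>k\<in>F j. \<beta> j k)"
      using lim that by (intro tendsto_sum) auto
    moreover have "(\<lambda>n. \<Sum>k\<in>F j. b (r n) j k) = (\<lambda>n. 1)"
      using b(1) that by (auto simp: weight_systems_def)
    ultimately show ?thesis by (simp add: LIMSEQ_const_iff)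
  qed
  ultimately have \<beta>: "\<beta> \<in> weight_systems F" by (auto simp: weight_systems_def)
  have "(\<lambda>n. G (b (r n))) \<longlonglongrightarrow> G \<beta>"
    unfolding G_def V_def[symmetric]
  proof (rule integral_dominated_convergence[where w = D])
    show "AE x in M. (\<lambda>n. V (b (r n)) x) \<longlonglongrightarrow> V \<beta> x"
    proof (rule AE_I2)
      fix x assume "x \<in> space M"
      then show "(\<lambda>n. V (b (r n)) x) \<longlonglongrightarrow> V \<beta> x"
        unfolding V_def using lim nonneg b(1)
        by (intro tendsto_gm tendsto_sum tendsto_mult tendsto_const sum_nonneg)
           (auto simp: weight_systems_def)
    qed
    show "AE x in M. norm (V (b (r n)) x) \<le> D x" for n
      using V_le_D[OF b(1)] V_nonneg by (auto intro!: AE_I2)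
  qed (use V_meas D_int in auto)
  moreover have "(\<lambda>n. s - 1 / Suc n) \<longlonglongrightarrow> s - 0"
    using LIMSEQ_inverse_real_of_nat unfolding inverse_eq_divide
    by (intro tendsto_diff tendsto_const)
  moreover have "s - 1 / Suc n \<le> G (b (r n))" for n
  proof -
    have "1 / real (Suc (r n)) \<le> 1 / real (Suc n)"
      using seq_suble[OF r, of n] by (intro divide_left_mono) auto
    then show ?thesis using b(2)[of "r n"] by linarith
  qed
  ultimately have "s \<le> G \<beta>" using LIMSEQ_le[of "\<lambda>n. s - 1 / Suc n" s] by auto
  then have "G \<beta>' \<le> G \<beta>" if "\<beta>' \<in> weight_systems F" for \<beta>'
    using cSup_upper[OF imageI[OF that] bdd] by (simp add: s_def)
  then show thesis using that[OF \<beta>] int G_le[OF \<beta>] by (simp add: V_def[abs_def])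
qed

section \<open>Factorisation for finite families\<close>

text \<open>The Euler-Lagrange condition for the maximiser of \<open>weight_systems_attain_max\<close>. The difference quotients
of the integrand lack an evident integrable upper bound, so the limit is taken with Fatou's lemma.\<close>
lemma factorisation_of_finite_positive_families:
  fixes F :: "'j \<Rightarrow> 'k set" and w :: "'j \<Rightarrow> 'k \<Rightarrow> 'a \<Rightarrow> real" and B :: real
  assumes F: "\<And>j. j \<in> J \<Longrightarrow> finite (F j) \<and> F j \<noteq> {}"
    and meas: "\<And>j k. j \<in> J \<Longrightarrow> k \<in> F j \<Longrightarrow> w j k \<in> borel_measurable M"
    and pos: "\<And>j k x. j \<in> J \<Longrightarrow> k \<in> F j \<Longrightarrow> x \<in> space M \<Longrightarrow> 0 < w j k x"
    and "0 \<le> B"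
    and bound: "\<And>\<beta>. \<beta> \<in> weight_systems F \<Longrightarrow>
       (\<integral>\<^sup>+x. ennreal (gm (\<lambda>j. \<Sum>k\<in>F j. \<beta> j k * w j k x)) \<partial>M) \<le> ennreal B"
  obtains \<phi> where "\<And>j. j \<in> J \<Longrightarrow> \<phi> j \<in> borel_measurable M"
    "\<And>j x. j \<in> J \<Longrightarrow> x \<in> space M \<Longrightarrow> 0 < \<phi> j x"
    "\<And>x. x \<in> space M \<Longrightarrow> gm (\<lambda>j. \<phi> j x) = 1"
    "\<And>j k. j \<in> J \<Longrightarrow> k \<in> F j \<Longrightarrow> (\<integral>\<^sup>+x. ennreal (w j k x * \<phi> j x) \<partial>M) \<le> ennreal B"
proof -
  define V where "V \<beta> j x = (\<Sum>k\<in>F j. \<beta> j k * w j k x)" for \<beta> j x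
  define G where "G \<beta> = (\<integral>x. gm (\<lambda>j. V \<beta> j x) \<partial>M)" for \<beta>
  obtain \<beta> where \<beta>: "\<beta> \<in> weight_systems F"
    and max: "\<And>\<beta>'. \<beta>' \<in> weight_systems F \<Longrightarrow> G \<beta>' \<le> G \<beta>"
    and int: "\<And>\<beta>'. \<beta>' \<in> weight_systems F \<Longrightarrow> integrable M (\<lambda>x. gm (\<lambda>j. V \<beta>' j x))"
    and "G \<beta> \<le> B"
    using weight_systems_attain_max[of F w M B thesis] F meas pos \<open>0 \<le> B\<close> bound
    unfolding G_def V_def by (smt (verit) less_imp_le)
  have V_meas: "V \<beta> j \<in> borel_measurable M" if "j \<in> J" for j
    using meas that unfolding V_def by (intro borel_measurable_sum) auto
  have V_pos: "0 < V \<beta> j x" if "j \<in> J" "x \<in> space M" for j x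
    unfolding V_def using combination_pos[OF \<beta>, of j "\<lambda>k. w j k x"] F pos that by auto
  define P where "P x = gm (\<lambda>j. V \<beta> j x)" for x
  have P_pos: "0 < P x" if "x \<in> space M" for x
    unfolding P_def using V_pos that by (intro gm_pos) auto
  have P_meas: "P \<in> borel_measurable M"
    unfolding P_def[abs_def] using V_meas by (intro gm_measurable) auto
  define \<phi> where "\<phi> j x = P x / V \<beta> j x" for j x
  have "(\<integral>\<^sup>+x. ennreal (w j k x * \<phi> j x) \<partial>M) \<le> ennreal B" if j: "j \<in> J" and k: "k \<in> F j" for j k
  proof -
    define t where "t n = inverse (real (Suc (Suc n)))" for n
    have t: "0 < t n" "t n < 1" for n by (auto simp: t_def field_simps)
    have t_lim: "t \<longlonglongrightarrow> 0"
      unfolding t_def using LIMSEQ_Suc[OF LIMSEQ_inverse_real_of_nat] by simp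
    define b where "b n = \<beta>(j := \<lambda>i. (1 - t n) * \<beta> j i + (if i = k then t n else 0))" for n
    have b: "b n \<in> weight_systems F" for n
      using \<beta> j k t[of n] F by (auto simp: weight_systems_def b_def sum.distrib simp flip: sum_distrib_left)
    define \<rho> where "\<rho> x = w j k x / V \<beta> j x" for x
    have \<rho>_pos: "0 < \<rho> x" if "x \<in> space M" for x
      using pos V_pos j k that by (simp add: \<rho>_def)
    have \<rho>_meas: "\<rho> \<in> borel_measurable M"
      unfolding \<rho>_def[abs_def] using meas V_meas j k by simp
    have perturbed: "gm (\<lambda>i. V (b n) i x) = P x * (1 - t n + t n * \<rho> x) powr \<theta> j"
      if x: "x \<in> space M" for n x
    proof -
      have "V (b n) j x = (1 - t n) * V \<beta> j x + (\<Sum>i\<in>F j. (if i = k then t n else 0) * w j i x)"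
        by (simp add: V_def b_def ring_distribs sum.distrib sum_distrib_left mult.assoc)
      also have "(\<Sum>i\<in>F j. (if i = k then t n else 0) * w j i x) = t n * w j k x"
        using F j k by (simp add: if_distrib[of "\<lambda>c. c * _"] cong: if_cong)
      finally have "(\<lambda>i. V (b n) i x) = (\<lambda>i. V \<beta> i x)(j := (1 - t n) * V \<beta> j x + t n * w j k x)"
        by (auto simp: V_def b_def fun_eq_iff)
      moreover have "((1 - t n) * V \<beta> j x + t n * w j k x) / V \<beta> j x = 1 - t n + t n * \<rho> x"
        using V_pos[OF j x] by (simp add: \<rho>_def field_simps)
      moreover have "0 \<le> (1 - t n) * V \<beta> j x + t n * w j k x"
        using V_pos[OF j x] pos[OF j k x] t[of n] by auto
      ultimately show ?thesis
        using gm_fun_upd[of j "\<lambda>i. V \<beta> i x"] j V_pos[OF j x] by (simp add: P_def)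
    qed
    define c where "c n = (1 - t n) powr \<theta> j" for n
    \<comment> \<open>The quotient compares the perturbed integrand with \<open>c n * P\<close>, what is left of the old one after the
      loss of weight, and not with \<open>P\<close>: this makes it non-negative, as Fatou's lemma requires.\<close>
    define f where "f n x = P x * ((1 - t n + t n * \<rho> x) powr \<theta> j - c n) / (t n * \<theta> j)" for n x
    have f_nonneg: "0 \<le> f n x" if "x \<in> space M" for n x
    proof -
      have "c n \<le> (1 - t n + t n * \<rho> x) powr \<theta> j"
        unfolding c_def using t[of n] \<rho>_pos[OF that] weight_pos[OF j] by (intro powr_mono2) auto
      then show ?thesis using P_pos[OF that] t[of n] weight_pos[OF j] by (simp add: f_def)
    qed
    have f_meas: "f n \<in> borel_measurable M" for n
      unfolding f_def[abs_def] using P_meas \<rho>_meas by measurable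
    have f_integral: "(\<integral>\<^sup>+x. ennreal (f n x) \<partial>M) \<le> ennreal (G \<beta> * (1 - c n) / (t n * \<theta> j))" for n
    proof -
      have eq: "f n x = (gm (\<lambda>i. V (b n) i x) - c n * P x) / (t n * \<theta> j)" if "x \<in> space M" for x
        using perturbed[OF that] by (simp add: f_def algebra_simps)
      have I: "integrable M (\<lambda>x. (gm (\<lambda>i. V (b n) i x) - c n * P x) / (t n * \<theta> j))"
        using int[OF b] int[OF \<beta>] unfolding P_def by auto
      then have "integrable M (f n)"
        using eq by (simp cong: Bochner_Integration.integrable_cong)
      then have "(\<integral>\<^sup>+x. ennreal (f n x) \<partial>M) = ennreal (\<integral>x. f n x \<partial>M)"
        using f_nonneg by (intro nn_integral_eq_integral) auto
      also have "(\<integral>x. f n x \<partial>M) = (\<integral>x. (gm (\<lambda>i. V (b n) i x) - c n * P x) / (t n * \<theta> j) \<partial>M)"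
        using eq by (intro Bochner_Integration.integral_cong) auto
      also have "\<dots> = (G (b n) - c n * G \<beta>) / (t n * \<theta> j)"
        using int[OF b] int[OF \<beta>] unfolding G_def P_def by simp
      also have "\<dots> \<le> (G \<beta> - c n * G \<beta>) / (t n * \<theta> j)"
        using max[OF b] t[of n] weight_pos[OF j] by (intro divide_right_mono) auto
      also have "\<dots> = G \<beta> * (1 - c n) / (t n * \<theta> j)" by (simp add: algebra_simps)
      finally show ?thesis by (simp add: ennreal_leI)
    qed
    have quotient: "(\<lambda>n. ((1 - t n + t n * y) powr \<theta> j - 1) / t n) \<longlonglongrightarrow> \<theta> j * (y - 1)" for y
      using t(1) by (intro first_variation_quotient t_lim) (simp add: less_imp_neq[symmetric])
    have c_lim: "(\<lambda>n. (c n - 1) / t n) \<longlonglongrightarrow> - \<theta> j"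
      using quotient[of 0] by (simp add: c_def)
    have f_lim: "(\<lambda>n. f n x) \<longlonglongrightarrow> P x * \<rho> x" for x
    proof -
      have "(\<lambda>n. P x * (((1 - t n + t n * \<rho> x) powr \<theta> j - 1) / t n - (c n - 1) / t n) / \<theta> j)
          \<longlonglongrightarrow> P x * (\<theta> j * (\<rho> x - 1) - (- \<theta> j)) / \<theta> j"
        using weight_pos[OF j] by (intro tendsto_intros quotient c_lim) auto
      moreover have "P x * (\<theta> j * (\<rho> x - 1) - (- \<theta> j)) / \<theta> j = P x * \<rho> x"
        using weight_pos[OF j] by (simp add: field_simps)
      moreover have "P x * (((1 - t n + t n * \<rho> x) powr \<theta> j - 1) / t n - (c n - 1) / t n) / \<theta> j = f n x" for n
        by (simp add: f_def flip: diff_divide_distrib)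
      ultimately show ?thesis by simp
    qed
    have "(\<lambda>n. G \<beta> * - ((c n - 1) / t n) / \<theta> j) \<longlonglongrightarrow> G \<beta> * - (- \<theta> j) / \<theta> j"
      using weight_pos[OF j] by (intro tendsto_intros c_lim) auto
    moreover have "G \<beta> * - ((c n - 1) / t n) / \<theta> j = G \<beta> * (1 - c n) / (t n * \<theta> j)" for n
      unfolding minus_divide_left by simp
    ultimately have "(\<lambda>n. G \<beta> * (1 - c n) / (t n * \<theta> j)) \<longlonglongrightarrow> G \<beta>"
      using weight_pos[OF j] by simp
    then have G_lim: "(\<lambda>n. ennreal (G \<beta> * (1 - c n) / (t n * \<theta> j))) \<longlonglongrightarrow> ennreal (G \<beta>)"
      by (rule tendsto_ennrealI)
    have "(\<integral>\<^sup>+x. ennreal (w j k x * \<phi> j x) \<partial>M) = (\<integral>\<^sup>+x. liminf (\<lambda>n. ennreal (f n x)) \<partial>M)"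
    proof (intro nn_integral_cong)
      fix x
      have "liminf (\<lambda>n. ennreal (f n x)) = ennreal (P x * \<rho> x)"
        using f_lim by (intro lim_imp_Liminf tendsto_ennrealI) auto
      then show "ennreal (w j k x * \<phi> j x) = liminf (\<lambda>n. ennreal (f n x))"
        by (simp add: \<phi>_def \<rho>_def mult.commute)
    qed
    also have "\<dots> \<le> liminf (\<lambda>n. \<integral>\<^sup>+x. ennreal (f n x) \<partial>M)"
      using f_meas by (intro nn_integral_liminf) auto
    also have "\<dots> \<le> liminf (\<lambda>n. ennreal (G \<beta> * (1 - c n) / (t n * \<theta> j)))"
      using f_integral by (intro Liminf_mono) auto
    also have "\<dots> = ennreal (G \<beta>)"
      using G_lim by (intro lim_imp_Liminf) auto
    also have "\<dots> \<le> ennreal B" using \<open>G \<beta> \<le> B\<close> by (rule ennreal_leI)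
    finally show ?thesis .
  qed
  moreover have "gm (\<lambda>j. \<phi> j x) = 1" if "x \<in> space M" for x
    unfolding \<phi>_def P_def using V_pos that by (intro gm_divide_self) auto
  moreover have "\<phi> j \<in> borel_measurable M" if "j \<in> J" for j
    unfolding \<phi>_def[abs_def] using P_meas V_meas[OF that] by simp
  moreover have "0 < \<phi> j x" if "j \<in> J" "x \<in> space M" for j x
    using V_pos[OF that] P_pos[OF that(2)] by (simp add: \<phi>_def)
  ultimately show thesis using that by blast
qed

text \<open>Zeros of the functions are removed by adding to each \<open>u j k\<close> the function \<open>b powr (1 / \<theta> j)\<close>, whose
\<open>\<theta> j\<close>-th power \<open>b\<close> is the same for all \<open>j\<close>. By subadditivity of the powers and \<open>prod_add_le\<close> this raises
the integrand by at most \<open>b * (W + 2) ^ card J\<close> for all weights at once, and \<open>b\<close> is chosen so that this is below a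
function \<open>\<eta>\<close> of integral at most \<open>\<epsilon>\<close>.\<close>
lemma factorisation_of_finite_families_up_to:
  fixes F :: "'j \<Rightarrow> 'k set" and u :: "'j \<Rightarrow> 'k \<Rightarrow> 'a \<Rightarrow> real" and A \<epsilon> :: real
  assumes sigma_finite: "sigma_finite_measure M"
    and F: "\<And>j. j \<in> J \<Longrightarrow> finite (F j) \<and> F j \<noteq> {}"
    and meas: "\<And>j k. j \<in> J \<Longrightarrow> k \<in> F j \<Longrightarrow> u j k \<in> borel_measurable M"
    and nonneg: "\<And>j k x. j \<in> J \<Longrightarrow> k \<in> F j \<Longrightarrow> x \<in> space M \<Longrightarrow> 0 \<le> u j k x"
    and "0 \<le> A" "0 < \<epsilon>"
    and bound: "\<And>\<beta>. \<beta> \<in> weight_systems F \<Longrightarrow>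
       (\<integral>\<^sup>+x. ennreal (gm (\<lambda>j. \<Sum>k\<in>F j. \<beta> j k * u j k x)) \<partial>M) \<le> ennreal A"
  obtains \<phi> where "\<And>j. j \<in> J \<Longrightarrow> \<phi> j \<in> borel_measurable M"
    "\<And>j x. j \<in> J \<Longrightarrow> x \<in> space M \<Longrightarrow> 0 < \<phi> j x"
    "\<And>x. x \<in> space M \<Longrightarrow> gm (\<lambda>j. \<phi> j x) = 1"
    "\<And>j k. j \<in> J \<Longrightarrow> k \<in> F j \<Longrightarrow> (\<integral>\<^sup>+x. ennreal (u j k x * \<phi> j x) \<partial>M) \<le> ennreal (A + \<epsilon>)"
proof -
  obtain \<eta> where \<eta>_meas: "\<eta> \<in> borel_measurable M" and \<eta>_pos: "\<And>x. 0 < \<eta> x"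
    and \<eta>_int: "(\<integral>\<^sup>+x. ennreal (\<eta> x) \<partial>M) \<le> ennreal \<epsilon>"
    using exists_positive_integrand_le[OF sigma_finite \<open>0 < \<epsilon>\<close>] by metis
  define W where "W x = (\<Sum>j\<in>J. (\<Sum>k\<in>F j. u j k x) powr \<theta> j)" for x
  have W_nonneg: "0 \<le> W x" for x by (auto simp: W_def intro: sum_nonneg)
  have W_meas: "W \<in> borel_measurable M"
    unfolding W_def[abs_def] using meas by (intro borel_measurable_sum powr_real_measurable) auto
  define b where "b x = min 1 (\<eta> x / (W x + 2) ^ card J)" for x
  have b: "0 < b x" "b x \<le> 1" for x
    using \<eta>_pos[of x] W_nonneg[of x] by (auto simp: b_def intro!: divide_pos_pos zero_less_power)
  have b_eta: "b x * (W x + 2) ^ card J \<le> \<eta> x" for x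
  proof -
    have "b x * (W x + 2) ^ card J \<le> \<eta> x / (W x + 2) ^ card J * (W x + 2) ^ card J"
      using W_nonneg[of x] by (intro mult_right_mono) (auto simp: b_def)
    also have "\<dots> = \<eta> x" using W_nonneg[of x] by simp
    finally show ?thesis .
  qed
  have b_meas: "b \<in> borel_measurable M"
    unfolding b_def[abs_def] using \<eta>_meas W_meas by measurable
  define w where "w j k x = u j k x + b x powr (1 / \<theta> j)" for j k x
  have "(\<integral>\<^sup>+x. ennreal (gm (\<lambda>j. \<Sum>k\<in>F j. \<beta> j k * w j k x)) \<partial>M) \<le> ennreal (A + \<epsilon>)"
    if \<beta>: "\<beta> \<in> weight_systems F" for \<beta>
  proof -
    let ?V = "\<lambda>x j. \<Sum>k\<in>F j. \<beta> j k * u j k x"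
    have le: "gm (\<lambda>j. \<Sum>k\<in>F j. \<beta> j k * w j k x) \<le> gm (?V x) + \<eta> x" if x: "x \<in> space M" for x
    proof -
      have V_nonneg: "0 \<le> ?V x j" if "j \<in> J" for j
        using \<beta> nonneg that x by (intro sum_nonneg) (auto simp: weight_systems_def)
      have V_le: "?V x j powr \<theta> j \<le> W x" if j: "j \<in> J" for j
      proof -
        have "?V x j \<le> (\<Sum>k\<in>F j. u j k x)"
          using \<beta> nonneg j x weight_systems_le_1[OF \<beta> j] F
          by (intro sum_mono mult_left_le_one_le) (auto simp: weight_systems_def)
        then have "?V x j powr \<theta> j \<le> (\<Sum>k\<in>F j. u j k x) powr \<theta> j"
          using V_nonneg[OF j] weight_pos[OF j] by (intro powr_mono2) auto
        also have "\<dots> \<le> W x"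
          unfolding W_def using finite_J j by (intro member_le_sum) auto
        finally show ?thesis .
      qed
      have "gm (\<lambda>j. \<Sum>k\<in>F j. \<beta> j k * w j k x) = gm (\<lambda>j. ?V x j + b x powr (1 / \<theta> j))"
        using \<beta> by (intro gm_cong)
          (auto simp: w_def ring_distribs sum.distrib weight_systems_def simp flip: sum_distrib_right)
      also have "\<dots> \<le> (\<Prod>j\<in>J. ?V x j powr \<theta> j + b x)"
        unfolding gm_def
      proof (intro prod_mono conjI)
        fix j assume j: "j \<in> J"
        have "(b x powr (1 / \<theta> j)) powr \<theta> j = b x"
          using weight_pos[OF j] b(1)[of x] by (simp add: powr_powr)
        then show "(?V x j + b x powr (1 / \<theta> j)) powr \<theta> j \<le> ?V x j powr \<theta> j + b x"
          using powr_add_le[OF V_nonneg[OF j], of "b x powr (1 / \<theta> j)" "\<theta> j"]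
            weight_pos[OF j] weight_le_1[OF j] by simp
      qed simp
      also have "\<dots> \<le> (\<Prod>j\<in>J. ?V x j powr \<theta> j) + b x * (W x + 2) ^ card J"
        using V_le W_nonneg b[of x] finite_J by (intro prod_add_le) auto
      also have "\<dots> \<le> gm (?V x) + \<eta> x" using b_eta by (simp add: gm_def)
      finally show ?thesis .
    qed
    have "(\<integral>\<^sup>+x. ennreal (gm (\<lambda>j. \<Sum>k\<in>F j. \<beta> j k * w j k x)) \<partial>M)
        \<le> (\<integral>\<^sup>+x. ennreal (gm (?V x)) + ennreal (\<eta> x) \<partial>M)"
      using le \<eta>_pos by (intro nn_integral_mono) (auto simp: less_imp_le ennreal_plus[symmetric] simp del: ennreal_plus intro!: ennreal_leI)
    also have "\<dots> = (\<integral>\<^sup>+x. ennreal (gm (?V x)) \<partial>M) + (\<integral>\<^sup>+x. ennreal (\<eta> x) \<partial>M)"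
      using meas \<eta>_meas
      by (intro nn_integral_add measurable_compose[OF _ measurable_ennreal] gm_measurable borel_measurable_sum) auto
    also have "\<dots> \<le> ennreal A + ennreal \<epsilon>" using bound[OF \<beta>] \<eta>_int by (rule add_mono)
    also have "\<dots> = ennreal (A + \<epsilon>)" using \<open>0 \<le> A\<close> \<open>0 < \<epsilon>\<close> by (simp add: ennreal_plus)
    finally show ?thesis .
  qed
  moreover have "w j k \<in> borel_measurable M" if "j \<in> J" "k \<in> F j" for j k
    unfolding w_def[abs_def] using meas[OF that] b_meas by measurable
  moreover have "0 < w j k x" if "j \<in> J" "k \<in> F j" "x \<in> space M" for j k x
    using nonneg[OF that] b(1)[of x] by (simp add: w_def add_nonneg_pos)
  ultimately obtain \<phi> where \<phi>: "\<And>j. j \<in> J \<Longrightarrow> \<phi> j \<in> borel_measurable M"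
    "\<And>j x. j \<in> J \<Longrightarrow> x \<in> space M \<Longrightarrow> 0 < \<phi> j x"
    "\<And>x. x \<in> space M \<Longrightarrow> gm (\<lambda>j. \<phi> j x) = 1"
    "\<And>j k. j \<in> J \<Longrightarrow> k \<in> F j \<Longrightarrow> (\<integral>\<^sup>+x. ennreal (w j k x * \<phi> j x) \<partial>M) \<le> ennreal (A + \<epsilon>)"
    using factorisation_of_finite_positive_families[of F w M "A + \<epsilon>" thesis] F \<open>0 \<le> A\<close> \<open>0 < \<epsilon>\<close> by force
  have "(\<integral>\<^sup>+x. ennreal (u j k x * \<phi> j x) \<partial>M) \<le> ennreal (A + \<epsilon>)" if "j \<in> J" "k \<in> F j" for j k
  proof -
    have "(\<integral>\<^sup>+x. ennreal (u j k x * \<phi> j x) \<partial>M) \<le> (\<integral>\<^sup>+x. ennreal (w j k x * \<phi> j x) \<partial>M)"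
      using \<phi>(2)[OF that(1)]
      by (intro nn_integral_mono ennreal_leI mult_right_mono) (auto simp: w_def less_imp_le)
    then show ?thesis using \<phi>(4)[OF that] by simp
  qed
  then show thesis using that \<phi> by blast
qed

end

section \<open>Common limits of convex constraints\<close>

text \<open>Half of the decay of the integrals pays for their summation, the other half for the weights \<open>2 ^ i\<close>, which
make the summability of squares strong enough for \<open>convergent_of_summable_weighted_squares\<close>.\<close>
lemma AE_summable_of_geometric_integrals:
  fixes f :: "nat \<Rightarrow> 'a \<Rightarrow> real"
  assumes int: "\<And>i. integrable N (f i)" and nonneg: "\<And>i x. 0 \<le> f i x"
    and le: "\<And>i. (\<integral>x. f i x \<partial>N) \<le> c * (1/4) ^ i"
  shows "AE x in N. summable (\<lambda>i. 2 ^ i * f i x)"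
proof -
  have c: "0 \<le> c" using order_trans[OF Bochner_Integration.integral_nonneg le[of 0]] nonneg by simp
  have [measurable]: "f i \<in> borel_measurable N" for i using int by auto
  have "(\<integral>\<^sup>+x. (\<Sum>i. ennreal (2 ^ i * f i x)) \<partial>N) = (\<Sum>i. \<integral>\<^sup>+x. ennreal (2 ^ i * f i x) \<partial>N)"
    by (intro nn_integral_suminf) auto
  also have "\<dots> = (\<Sum>i. ennreal (2 ^ i * (\<integral>x. f i x \<partial>N)))"
    using int nonneg by (subst nn_integral_eq_integral) auto
  also have "\<dots> \<le> (\<Sum>i. ennreal (c * (1/2) ^ i))"
  proof (intro suminf_le ennreal_leI)
    fix i
    have "2 ^ i * (\<integral>x. f i x \<partial>N) \<le> 2 ^ i * (c * (1/4) ^ i)"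
      using le by (intro mult_left_mono) auto
    also have "\<dots> = c * (2 * (1/4)) ^ i" by (simp only: power_mult_distrib mult_ac)
    finally show "2 ^ i * (\<integral>x. f i x \<partial>N) \<le> c * (1/2) ^ i" by simp
  qed auto
  also have "\<dots> = ennreal (\<Sum>i. c * (1/2) ^ i)"
    using c by (intro suminf_ennreal2) (auto intro!: summable_mult summable_geometric)
  also have "\<dots> < \<infinity>" by simp
  finally have "AE x in N. (\<Sum>i. ennreal (2 ^ i * f i x)) \<noteq> \<infinity>"
    by (intro nn_integral_PInf_AE) auto
  then show ?thesis
    by (rule AE_mp) (use nonneg in \<open>auto intro!: AE_I2 summable_suminf_not_top\<close>)
qed

text \<open>Since \<open>a \<le> 1 / p + p * a\<^sup>2\<close> for \<open>p > 0\<close>, the increments themselves are summable.\<close>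
lemma convergent_of_summable_weighted_squares:
  fixes e :: "nat \<Rightarrow> real"
  assumes "summable (\<lambda>i. 2 ^ i * (e (Suc i) - e i)\<^sup>2)"
  shows "convergent e"
proof -
  have step: "norm (e (Suc i) - e i) \<le> (1/2) ^ i + 2 ^ i * (e (Suc i) - e i)\<^sup>2" for i
  proof -
    let ?a = "\<bar>e (Suc i) - e i\<bar>" and ?p = "2 ^ i :: real"
    have "0 \<le> (1 - ?p * ?a)\<^sup>2" by simp
    moreover have "0 \<le> ?p * ?a" by simp
    ultimately have "?p * ?a \<le> 1 + (?p * ?a)\<^sup>2"
      unfolding power2_diff power_one mult_1_right by linarith
    then have "?p * ?a \<le> 1 + ?p * (?p * ?a\<^sup>2)"
      by (simp add: power2_eq_square mult_ac)
    then have "?a \<le> (1 + ?p * (?p * ?a\<^sup>2)) / ?p" by (simp add: field_simps)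
    then show ?thesis by (simp add: add_divide_distrib power_one_over)
  qed
  have "summable (\<lambda>i. (1/2) ^ i + 2 ^ i * (e (Suc i) - e i)\<^sup>2)"
    by (intro summable_add assms summable_geometric) simp
  then have "summable (\<lambda>i. e (Suc i) - e i)"
    using step by (rule summable_comparison_test'[where N = 0])
  then have "(\<lambda>n. e n - e 0) \<longlonglongrightarrow> (\<Sum>i. e (Suc i) - e i)"
    using summable_LIMSEQ[of "\<lambda>i. e (Suc i) - e i"] by (simp add: sum_lessThan_telescope)
  then have "(\<lambda>n. (e n - e 0) + e 0) \<longlonglongrightarrow> (\<Sum>i. e (Suc i) - e i) + e 0"
    by (intro tendsto_add tendsto_const)
  then show ?thesis by (auto simp: convergent_def)
qed

text \<open>A finite intersection property for convex conditions on non-negative functions, with convergence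
almost everywhere. For \<open>E \<psi> = (\<Sum>j\<in>J. \<integral> (exp (- \<psi> j))\<^sup>2)\<close>, let \<open>s\<close> be the supremum, over finite sets \<open>F\<close>
of constraints, of the infimum of \<open>E\<close> subject to \<open>F\<close>. If \<open>F i\<close> comes within \<open>(1/4) ^ i\<close> of \<open>s\<close>, then any two tuples subject to \<open>F i\<close>
with \<open>E\<close> close to \<open>s\<close> have exponentials that are close in \<open>L\<^sup>2\<close>, because the value of \<open>E\<close> at their midpoint cannot
drop much below \<open>s\<close>. Choosing such tuples for each \<open>i\<close> gives the limit \<open>g\<close>; choosing them subject to one more
constraint \<open>q\<close> is possible, since \<open>E\<close> can still be brought close to \<open>s\<close>, and gives the same limit.\<close>
lemma midpoint_closed_constraints_common_limit:
  fixes X :: "('j \<Rightarrow> 'a \<Rightarrow> real) set" and D :: "'q \<Rightarrow> ('j \<Rightarrow> 'a \<Rightarrow> real) set"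
  assumes N: "finite_measure N" and J: "finite J"
    and meas: "\<And>\<psi> j. \<psi> \<in> X \<Longrightarrow> j \<in> J \<Longrightarrow> \<psi> j \<in> borel_measurable N"
    and nonneg: "\<And>\<psi> j x. \<psi> \<in> X \<Longrightarrow> j \<in> J \<Longrightarrow> x \<in> space N \<Longrightarrow> 0 \<le> \<psi> j x"
    and midX: "\<And>\<psi> \<psi>'. \<psi> \<in> X \<Longrightarrow> \<psi>' \<in> X \<Longrightarrow> (\<lambda>j x. (\<psi> j x + \<psi>' j x) / 2) \<in> X"
    and midD: "\<And>q \<psi> \<psi>'. q \<in> Q \<Longrightarrow> \<psi> \<in> X \<inter> D q \<Longrightarrow> \<psi>' \<in> X \<inter> D q \<Longrightarrow>
      (\<lambda>j x. (\<psi> j x + \<psi>' j x) / 2) \<in> D q"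
    and fip: "\<And>F. finite F \<Longrightarrow> F \<subseteq> Q \<Longrightarrow> \<exists>\<psi>\<in>X. \<forall>q\<in>F. \<psi> \<in> D q"
  obtains g :: "'j \<Rightarrow> 'a \<Rightarrow> real" where
    "\<And>j. j \<in> J \<Longrightarrow> g j \<in> borel_measurable N" "\<And>j x. g j x \<in> {0..1}"
    "\<And>q. q \<in> Q \<Longrightarrow> \<exists>\<psi>. (\<forall>n::nat. \<psi> n \<in> X \<inter> D q) \<and>
       (AE x in N. \<forall>j\<in>J. (\<lambda>n. exp (- \<psi> n j x)) \<longlonglongrightarrow> g j x)"
proof -
  interpret finite_measure N by (rule N)
  define C where "C F = {\<psi> \<in> X. \<forall>q\<in>F. \<psi> \<in> D q}" for F
  define mid where "mid \<psi> \<psi>' = (\<lambda>j x. (\<psi> j x + \<psi>' j x) / 2)" for \<psi> \<psi>' :: "'j \<Rightarrow> 'a \<Rightarrow> real"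
  define E where "E \<psi> = (\<Sum>j\<in>J. \<integral>x. (exp (- \<psi> j x))\<^sup>2 \<partial>N)" for \<psi> :: "'j \<Rightarrow> 'a \<Rightarrow> real"
  define gap where "gap \<psi> \<psi>' (x::'a) = (\<Sum>j\<in>J. (exp (- \<psi>' j x) - exp (- \<psi> j x))\<^sup>2)" for \<psi> \<psi>' :: "'j \<Rightarrow> 'a \<Rightarrow> real" and x
  have int_prod: "integrable N (\<lambda>x. exp (- \<psi> j x) * exp (- \<psi>' j x))"
    if "\<psi> \<in> X" "\<psi>' \<in> X" "j \<in> J" for \<psi> \<psi>' j
  proof (rule integrable_const_bound[where B = 1])
    show "AE x in N. norm (exp (- \<psi> j x) * exp (- \<psi>' j x)) \<le> 1"
      using nonneg that by (intro AE_I2) (auto intro!: mult_le_one)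
  qed (use meas that in measurable)
  have int_sq: "integrable N (\<lambda>x. (exp (- \<psi> j x))\<^sup>2)" if "\<psi> \<in> X" "j \<in> J" for \<psi> j
    using int_prod[OF that(1) that] by (simp add: power2_eq_square)
  \<comment> \<open>The parallelogram identity: the mixed product of the exponentials is the square of the
    exponential at the midpoint.\<close>
  have gap_eq: "(exp (- \<psi>' j x) - exp (- \<psi> j x))\<^sup>2 =
      (exp (- \<psi> j x))\<^sup>2 + (exp (- \<psi>' j x))\<^sup>2 - 2 * (exp (- mid \<psi> \<psi>' j x))\<^sup>2" for \<psi> \<psi>' j x
    by (simp add: mid_def power2_eq_square algebra_simps flip: exp_add exp_minus)
  have mid_C: "mid \<psi> \<psi>' \<in> C F" if "\<psi> \<in> C F" "\<psi>' \<in> C F" "F \<subseteq> Q" for \<psi> \<psi>' F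
    using that midX[of \<psi> \<psi>'] midD[of _ \<psi> \<psi>'] by (auto simp: C_def mid_def)
  have CX: "\<psi> \<in> X" if "\<psi> \<in> C F" for \<psi> F using that by (simp add: C_def)
  have gap_int: "integrable N (gap \<psi> \<psi>')" if "\<psi> \<in> X" "\<psi>' \<in> X" for \<psi> \<psi>'
    using int_sq that midX[OF that] unfolding gap_def[abs_def] gap_eq mid_def[symmetric]
    by (intro Bochner_Integration.integrable_sum Bochner_Integration.integrable_diff
        Bochner_Integration.integrable_add integrable_mult_right) auto
  have gap_integral: "(\<integral>x. gap \<psi> \<psi>' x \<partial>N) = E \<psi> + E \<psi>' - 2 * E (mid \<psi> \<psi>')"
    if "\<psi> \<in> X" "\<psi>' \<in> X" for \<psi> \<psi>'
  proof -
    have m: "mid \<psi> \<psi>' \<in> X" using midX[OF that] by (simp add: mid_def)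
    show ?thesis
      unfolding gap_def[abs_def] gap_eq E_def using int_sq that m
      by (subst Bochner_Integration.integral_sum)
         (auto simp: sum.distrib sum_subtractf sum_distrib_left)
  qed
  have E_nonneg: "0 \<le> E \<psi>" for \<psi>
    by (auto simp: E_def intro!: sum_nonneg Bochner_Integration.integral_nonneg)
  define m where "m F = Inf (E ` C F)" for F
  have bdd_below: "bdd_below (E ` S)" for S using E_nonneg by (rule bdd_belowI2)
  have C_ne: "C F \<noteq> {}" if "finite F" "F \<subseteq> Q" for F
    using fip[OF that] by (auto simp: C_def)
  define \<F> where "\<F> = {F. finite F \<and> F \<subseteq> Q}"
  have E_le: "E \<psi> \<le> (\<Sum>j\<in>J. measure N (space N))" if "\<psi> \<in> X" for \<psi>
    unfolding E_def
  proof (intro sum_mono)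
    fix j assume j: "j \<in> J"
    have "(\<integral>x. (exp (- \<psi> j x))\<^sup>2 \<partial>N) \<le> (\<integral>x. 1 \<partial>N)"
      using int_sq[OF that j] nonneg[OF that j] by (intro integral_mono) (auto intro!: power_le_one)
    then show "(\<integral>x. (exp (- \<psi> j x))\<^sup>2 \<partial>N) \<le> measure N (space N)" by simp
  qed
  have "bdd_above (m ` \<F>)"
  proof (rule bdd_aboveI2)
    fix F assume "F \<in> \<F>"
    then obtain \<psi> where "\<psi> \<in> C F" using C_ne by (auto simp: \<F>_def)
    then show "m F \<le> (\<Sum>j\<in>J. measure N (space N))"
      using cInf_lower[OF imageI bdd_below, of \<psi> "C F"] E_le[OF CX] unfolding m_def by fastforce
  qed
  define s where "s = Sup (m ` \<F>)"
  have m_le: "m F \<le> s" if "F \<in> \<F>" for F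
    unfolding s_def using that \<open>bdd_above (m ` \<F>)\<close> by (auto intro: cSup_upper)
  have "\<exists>F\<in>\<F>. s - (1/4) ^ i < m F" for i :: nat
  proof -
    have "s - (1/4) ^ i < Sup (m ` \<F>)" by (simp add: s_def)
    moreover have "m ` \<F> \<noteq> {}" unfolding \<F>_def by blast
    ultimately show ?thesis using less_cSupD[of "m ` \<F>" "s - (1/4) ^ i"] by blast
  qed
  then obtain F0 where F0: "\<And>i. F0 i \<in> \<F>" "\<And>i::nat. s - (1/4) ^ i < m (F0 i)" by metis
  define F where "F i = (\<Union>l\<le>i. F0 l)" for i
  have F: "F i \<in> \<F>" for i using F0(1) by (auto simp: F_def \<F>_def)
  have F_mono: "F i \<subseteq> F l" if "i \<le> l" for i l
    unfolding F_def using that by (intro UN_mono) auto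
  have E_lower: "s - (1/4) ^ i < E \<psi>" if "\<psi> \<in> C (F i)" for \<psi> i
  proof -
    have "\<psi> \<in> C (F0 i)" using that by (auto simp: C_def F_def)
    then have "m (F0 i) \<le> E \<psi>" unfolding m_def by (intro cInf_lower bdd_below) auto
    then show ?thesis using F0(2)[of i] by linarith
  qed
  have near_min: "\<exists>\<psi>\<in>C F. E \<psi> < s + (1/4) ^ i" if "F \<in> \<F>" for F and i :: nat
  proof -
    have "m F < s + (1/4) ^ i"
      by (rule le_less_trans[OF m_le[OF that]]) simp
    moreover have "E ` C F \<noteq> {}" using C_ne that by (simp add: \<F>_def)
    ultimately show ?thesis using cInf_lessD[of "E ` C F"] unfolding m_def by blast
  qed
  have gap_small: "(\<integral>x. gap \<psi> \<psi>' x \<partial>N) \<le> 4 * (1/4) ^ i"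
    if "\<psi> \<in> C (F i)" "\<psi>' \<in> C (F i)" "E \<psi> < s + (1/4) ^ i" "E \<psi>' < s + (1/4) ^ i" for \<psi> \<psi>' i
  proof -
    have "mid \<psi> \<psi>' \<in> C (F i)" using mid_C that F by (auto simp: \<F>_def)
    then have "s - (1/4) ^ i < E (mid \<psi> \<psi>')" by (rule E_lower)
    then show ?thesis using gap_integral[of \<psi> \<psi>'] that CX by fastforce
  qed
  obtain p where p: "\<And>i. p i \<in> C (F i)" "\<And>i::nat. E (p i) < s + (1/4) ^ i"
    using choice[of "\<lambda>i \<psi>. \<psi> \<in> C (F i) \<and> E \<psi> < s + (1/4) ^ i"] near_min[OF F] by blast
  have p_later: "p (Suc i) \<in> C (F i)" "E (p (Suc i)) < s + (1/4) ^ i" for i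
  proof -
    show "p (Suc i) \<in> C (F i)" using p(1)[of "Suc i"] F_mono[of i "Suc i"] by (auto simp: C_def)
    have "(1/4::real) ^ Suc i \<le> (1/4) ^ i" by (intro power_decreasing) auto
    then show "E (p (Suc i)) < s + (1/4) ^ i" using p(2)[of "Suc i"] by linarith
  qed
  have gap_nonneg: "0 \<le> gap \<psi> \<psi>' x" for \<psi> \<psi>' x by (auto simp: gap_def intro!: sum_nonneg)
  have sq_le_gap: "(exp (- \<psi>' j x) - exp (- \<psi> j x))\<^sup>2 \<le> gap \<psi> \<psi>' x" if "j \<in> J" for \<psi> \<psi>' j x
    unfolding gap_def using J that by (intro member_le_sum) auto
  have "AE x in N. summable (\<lambda>i. 2 ^ i * gap (p i) (p (Suc i)) x)"
    using gap_int CX p p_later gap_small gap_nonneg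
    by (intro AE_summable_of_geometric_integrals[where c = 4]) blast+
  then have conv: "AE x in N. \<forall>j\<in>J. convergent (\<lambda>i. exp (- p i j x))"
  proof eventually_elim
    case (elim x)
    show ?case
    proof
      fix j assume j: "j \<in> J"
      show "convergent (\<lambda>i. exp (- p i j x))"
        using sq_le_gap[OF j]
        by (intro convergent_of_summable_weighted_squares summable_comparison_test'[OF elim])
           (auto intro!: mult_left_mono)
    qed
  qed
  define g where "g j x = max 0 (min 1 (lim (\<lambda>i. exp (- p i j x))))" for j x
  have p_lim: "(\<lambda>i. exp (- p i j x)) \<longlonglongrightarrow> g j x"
    if "convergent (\<lambda>i. exp (- p i j x))" "j \<in> J" "x \<in> space N" for j x
  proof -
    let ?l = "lim (\<lambda>i. exp (- p i j x))"
    have l: "(\<lambda>i. exp (- p i j x)) \<longlonglongrightarrow> ?l" using that by (simp add: convergent_LIMSEQ_iff)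
    have "0 \<le> ?l" by (rule LIMSEQ_le_const[OF l]) auto
    moreover have "?l \<le> 1"
      using nonneg[OF CX[OF p(1)] that(2,3)] by (intro LIMSEQ_le_const2[OF l]) auto
    ultimately show ?thesis using l by (simp add: g_def)
  qed
  show thesis
  proof
    show "g j \<in> borel_measurable N" if "j \<in> J" for j
    proof -
      have [measurable]: "p i j \<in> borel_measurable N" for i using meas[OF CX[OF p(1)] that] .
      show ?thesis unfolding g_def[abs_def] by measurable
    qed
    show "g j x \<in> {0..1}" for j x by (simp add: g_def)
    fix q assume q: "q \<in> Q"
    have "insert q (F i) \<in> \<F>" for i using F q by (auto simp: \<F>_def)
    then obtain \<psi> where \<psi>: "\<And>i. \<psi> i \<in> C (insert q (F i))" "\<And>i::nat. E (\<psi> i) < s + (1/4) ^ i"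
      using choice[of "\<lambda>i \<psi>. \<psi> \<in> C (insert q (F i)) \<and> E \<psi> < s + (1/4) ^ i"] near_min by blast
    have \<psi>F: "\<psi> i \<in> C (F i)" for i using \<psi>(1)[of i] by (auto simp: C_def)
    have "AE x in N. summable (\<lambda>i. 2 ^ i * gap (p i) (\<psi> i) x)"
      using gap_int CX p \<psi>F \<psi>(2) gap_small gap_nonneg
      by (intro AE_summable_of_geometric_integrals[where c = 4]) blast+
    with conv have "AE x in N. \<forall>j\<in>J. (\<lambda>n. exp (- \<psi> n j x)) \<longlonglongrightarrow> g j x"
      using AE_space
    proof eventually_elim
      case (elim x)
      show ?case
      proof
        fix j assume j: "j \<in> J"
        let ?d = "\<lambda>i. exp (- \<psi> i j x) - exp (- p i j x)"
        have le: "(?d i)\<^sup>2 \<le> 2 ^ i * gap (p i) (\<psi> i) x" for i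
        proof -
          have "1 * gap (p i) (\<psi> i) x \<le> 2 ^ i * gap (p i) (\<psi> i) x"
            using gap_nonneg by (intro mult_right_mono) auto
          then show ?thesis using sq_le_gap[OF j, of "\<psi> i" x "p i"] by linarith
        qed
        have "(\<lambda>i. (?d i)\<^sup>2) \<longlonglongrightarrow> 0"
          using le by (intro tendsto_sandwich[OF _ _ tendsto_const summable_LIMSEQ_zero[OF elim(2)]]) auto
        then have "?d \<longlonglongrightarrow> 0" using tendsto_real_sqrt tendsto_rabs_zero_cancel by fastforce
        then have "(\<lambda>i. ?d i + exp (- p i j x)) \<longlonglongrightarrow> 0 + g j x"
          using p_lim elim j by (intro tendsto_add) auto
        then show "(\<lambda>n. exp (- \<psi> n j x)) \<longlonglongrightarrow> g j x" by simp
      qed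
    qed
    then show "\<exists>\<psi>. (\<forall>n::nat. \<psi> n \<in> X \<inter> D q) \<and>
       (AE x in N. \<forall>j\<in>J. (\<lambda>n. exp (- \<psi> n j x)) \<longlonglongrightarrow> g j x)"
      using \<psi>(1) by (intro exI[of _ \<psi>]) (auto simp: C_def)
  qed
qed

section \<open>Factorisation for saturating families\<close>

context geometric_weights
begin

text \<open>The bounds \<open>A + 1 / Suc n\<close> for all \<open>n\<close> are treated as separate constraints, so that each finite set of them
leaves a positive amount of room; their common limit then obeys the bound \<open>A\<close> itself.\<close>
theorem factorisation_of_saturating_families:
  fixes K :: "'j \<Rightarrow> 'k set" and u :: "'j \<Rightarrow> 'k \<Rightarrow> 'a \<Rightarrow> real" and A :: real
  assumes sigma_finite: "sigma_finite_measure M"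
    and sat: "\<And>j. j \<in> J \<Longrightarrow> saturating M (u j ` K j)"
    and nonneg: "\<And>j k x. j \<in> J \<Longrightarrow> k \<in> K j \<Longrightarrow> x \<in> space M \<Longrightarrow> 0 \<le> u j k x"
    and "0 \<le> A"
    and bound: "\<And>F \<beta>. (\<And>j. j \<in> J \<Longrightarrow> finite (F j) \<and> F j \<subseteq> K j) \<Longrightarrow> \<beta> \<in> weight_systems F \<Longrightarrow>
       (\<integral>\<^sup>+x. ennreal (gm (\<lambda>j. \<Sum>k\<in>F j. \<beta> j k * u j k x)) \<partial>M) \<le> ennreal A"
  shows "\<exists>\<phi>. (\<forall>j\<in>J. \<phi> j \<in> borel_measurable M \<and> (\<forall>x\<in>space M. 0 \<le> \<phi> j x)) \<and>
    (AE x in M. 1 \<le> gm (\<lambda>j. \<phi> j x)) \<and>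
    (\<forall>j\<in>J. \<forall>k\<in>K j. (\<integral>\<^sup>+x. ennreal (u j k x * \<phi> j x) \<partial>M) \<le> ennreal A)"
proof -
  have meas: "u j k \<in> borel_measurable M" if "j \<in> J" "k \<in> K j" for j k
    using sat[OF that(1)] that(2) unfolding saturating_def by blast
  have K_ne: "\<exists>k. k \<in> K j" if "j \<in> J" for j
    using sat[OF that] unfolding saturating_def by blast
  obtain h where h_meas: "h \<in> borel_measurable M" and h_pos: "\<And>x. 0 < h x"
    and h_int: "(\<integral>\<^sup>+x. ennreal (h x) \<partial>M) \<le> ennreal 1"
    using exists_positive_integrand_le[OF sigma_finite, of 1] by auto
  define N where "N = density M h"
  have sets_N: "sets N = sets M" and space_N: "space N = space M" by (auto simp: N_def)
  have "emeasure N (space N) = (\<integral>\<^sup>+x. ennreal (h x) \<partial>M)"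
    using h_meas by (simp add: N_def emeasure_density cong: nn_integral_cong)
  then have N: "finite_measure N"
    using h_int by (intro finite_measureI) (auto simp: top_unique)
  have AE_N: "(AE x in N. R x) \<longleftrightarrow> (AE x in M. R x)" for R
    unfolding N_def using h_meas h_pos by (subst AE_density) auto
  define X where "X = {\<psi>. (\<forall>j\<in>J. \<psi> j \<in> borel_measurable M) \<and>
    (\<forall>j\<in>J. \<forall>x\<in>space M. 0 \<le> \<psi> j x) \<and> (\<forall>x\<in>space M. 1 \<le> gm (\<lambda>j. \<psi> j x))}"
  define D where "D = (\<lambda>(j, k, n::nat).
    {\<psi>. (\<integral>\<^sup>+x. ennreal (u j k x * \<psi> j x) \<partial>M) \<le> ennreal (A + 1 / Suc n)})"
  define Q where "Q = {(j, k, n::nat). j \<in> J \<and> k \<in> K j}"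
  have midX: "(\<lambda>j x. (\<psi> j x + \<psi>' j x) / 2) \<in> X" if "\<psi> \<in> X" "\<psi>' \<in> X" for \<psi> \<psi>'
    using that 
    by (auto simp: X_def intro!: gm_midpoint_ge_1 add_nonneg_nonneg
        borel_measurable_divide borel_measurable_add borel_measurable_const)
  have midD: "(\<lambda>j x. (\<psi> j x + \<psi>' j x) / 2) \<in> D q"
    if q: "q \<in> Q" and "\<psi> \<in> X \<inter> D q" "\<psi>' \<in> X \<inter> D q" for q \<psi> \<psi>'
  proof -
    obtain j k n where jk: "q = (j, k, n)" "j \<in> J" "k \<in> K j" using q by (auto simp: Q_def)
    have I: "(\<integral>\<^sup>+x. ennreal (u j k x * \<psi> j x) \<partial>M) \<le> ennreal (A + 1 / Suc n)"
      "(\<integral>\<^sup>+x. ennreal (u j k x * \<psi>' j x) \<partial>M) \<le> ennreal (A + 1 / Suc n)"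
      using that jk by (auto simp: D_def)
    have m: "(\<lambda>x. u j k x * \<psi> j x) \<in> borel_measurable M" "(\<lambda>x. u j k x * \<psi>' j x) \<in> borel_measurable M"
      using that jk meas by (auto simp: X_def)
    have "(\<integral>\<^sup>+x. ennreal (u j k x * ((\<psi> j x + \<psi>' j x) / 2)) \<partial>M) =
        (\<integral>\<^sup>+x. ennreal (1/2) * (ennreal (u j k x * \<psi> j x) + ennreal (u j k x * \<psi>' j x)) \<partial>M)"
    proof (intro nn_integral_cong)
      fix x assume "x \<in> space M"
      then have "0 \<le> u j k x * \<psi> j x" "0 \<le> u j k x * \<psi>' j x"
        using that jk nonneg by (auto simp: X_def)
      then show "ennreal (u j k x * ((\<psi> j x + \<psi>' j x) / 2)) =
        ennreal (1/2) * (ennreal (u j k x * \<psi> j x) + ennreal (u j k x * \<psi>' j x))"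
        by (simp only: ennreal_midpoint) (simp add: distrib_left)
    qed
    also have "\<dots> = ennreal (1/2) *
        ((\<integral>\<^sup>+x. ennreal (u j k x * \<psi> j x) \<partial>M) + (\<integral>\<^sup>+x. ennreal (u j k x * \<psi>' j x) \<partial>M))"
      using m by (subst nn_integral_cmult) (auto simp: nn_integral_add)
    also have "\<dots> \<le> ennreal (1/2) * (ennreal (A + 1 / Suc n) + ennreal (A + 1 / Suc n))"
      using I by (intro mult_left_mono add_mono) auto
    also have "\<dots> = ennreal (A + 1 / Suc n)"
      using \<open>0 \<le> A\<close> ennreal_midpoint[of "A + 1 / Suc n" "A + 1 / Suc n"]
      by (simp del: ennreal_plus)
    finally show ?thesis by (simp add: D_def jk)
  qed
  have fip: "\<exists>\<psi>\<in>X. \<forall>q\<in>F. \<psi> \<in> D q" if F: "finite F" "F \<subseteq> Q" for F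
  proof -
    obtain k0 where k0: "\<And>j. j \<in> J \<Longrightarrow> k0 j \<in> K j" using K_ne by metis
    \<comment> \<open>The added index \<open>k0 j\<close> keeps the family non-empty when \<open>F\<close> has no constraint for \<open>j\<close>.\<close>
    define F' where "F' j = insert (k0 j) ((\<lambda>(_, k, _). k) ` {q\<in>F. fst q = j})" for j
    define m where "m = Max (insert 0 ((\<lambda>(_, _, n). n) ` F))"
    have F': "finite (F' j) \<and> F' j \<subseteq> K j" if "j \<in> J" for j
      using F k0 that by (auto simp: F'_def Q_def)
    have "\<exists>\<phi>. (\<forall>j\<in>J. \<phi> j \<in> borel_measurable M) \<and> (\<forall>j\<in>J. \<forall>x\<in>space M. 0 < \<phi> j x) \<and>
      (\<forall>x\<in>space M. gm (\<lambda>j. \<phi> j x) = 1) \<and>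
      (\<forall>j\<in>J. \<forall>k\<in>F' j. (\<integral>\<^sup>+x. ennreal (u j k x * \<phi> j x) \<partial>M) \<le> ennreal (A + 1 / Suc m))"
    proof (rule factorisation_of_finite_families_up_to[of M F' u A "1 / Suc m"])
      show "finite (F' j) \<and> F' j \<noteq> {}" if "j \<in> J" for j using F'[OF that] by (auto simp: F'_def)
      show "u j k \<in> borel_measurable M" if "j \<in> J" "k \<in> F' j" for j k
        using meas F' that by blast
      show "0 \<le> u j k x" if "j \<in> J" "k \<in> F' j" "x \<in> space M" for j k x
        using nonneg F' that by blast
      show "(\<integral>\<^sup>+x. ennreal (gm (\<lambda>j. \<Sum>k\<in>F' j. \<beta> j k * u j k x)) \<partial>M) \<le> ennreal A"
        if "\<beta> \<in> weight_systems F'" for \<beta> by (rule bound[OF F' that])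
      show "0 < 1 / real (Suc m)" by simp
    qed (use sigma_finite \<open>0 \<le> A\<close> in blast)+
    then obtain \<phi> where \<phi>: "\<forall>j\<in>J. \<phi> j \<in> borel_measurable M" "\<forall>j\<in>J. \<forall>x\<in>space M. 0 < \<phi> j x"
      "\<forall>x\<in>space M. gm (\<lambda>j. \<phi> j x) = 1"
      "\<forall>j\<in>J. \<forall>k\<in>F' j. (\<integral>\<^sup>+x. ennreal (u j k x * \<phi> j x) \<partial>M) \<le> ennreal (A + 1 / Suc m)"
      by blast
    have "\<phi> \<in> D q" if q: "q \<in> F" for q
    proof -
      obtain j k n where jk: "q = (j, k, n)" by (cases q) auto
      have "j \<in> J" "k \<in> F' j" using q F(2) jk by (force simp: Q_def F'_def)+
      then have "(\<integral>\<^sup>+x. ennreal (u j k x * \<phi> j x) \<partial>M) \<le> ennreal (A + 1 / Suc m)"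
        using \<phi>(4) by blast
      also have "n \<le> m" unfolding m_def using F(1) q jk by (intro Max_ge) force+
      then have "ennreal (A + 1 / Suc m) \<le> ennreal (A + 1 / Suc n)"
        by (intro ennreal_leI add_left_mono divide_left_mono) auto
      finally show ?thesis by (simp add: D_def jk)
    qed
    moreover have "\<phi> \<in> X" using \<phi> by (auto simp: X_def less_imp_le)
    ultimately show ?thesis by blast
  qed
  obtain g where g_meas: "\<And>j. j \<in> J \<Longrightarrow> g j \<in> borel_measurable N"
    and g_range: "\<And>j x. g j x \<in> {0..1}"
    and g_lim: "\<And>q. q \<in> Q \<Longrightarrow> \<exists>\<psi>. (\<forall>n::nat. \<psi> n \<in> X \<inter> D q) \<and>
       (AE x in N. \<forall>j\<in>J. (\<lambda>n. exp (- \<psi> n j x)) \<longlonglongrightarrow> g j x)"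
  proof (rule midpoint_closed_constraints_common_limit[of N J X Q D])
    show "\<psi> j \<in> borel_measurable N" if "\<psi> \<in> X" "j \<in> J" for \<psi> j
      using that by (simp add: X_def sets_N cong: measurable_cong_sets)
    show "0 \<le> \<psi> j x" if "\<psi> \<in> X" "j \<in> J" "x \<in> space N" for \<psi> j x
      using that by (simp add: X_def space_N)
  qed (use N finite_J midX midD fip in blast)+
  have g_meas: "g j \<in> borel_measurable M" if "j \<in> J" for j
    using g_meas[OF that] by (simp add: sets_N cong: measurable_cong_sets)
  \<comment> \<open>The limit of the functions as an extended real, and its real-valued version. As \<open>ln 0 = 0\<close>, the two
    differ exactly where \<open>g j x = 0\<close>.\<close>
  define \<Lambda> where "\<Lambda> j x = (if g j x = 0 then \<infinity> else ennreal (- ln (g j x)))" for j x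
  define \<phi> where "\<phi> j x = - ln (g j x)" for j x
  have \<phi>_nonneg: "0 \<le> \<phi> j x" for j x
    using g_range[of j x] by (cases "g j x = 0") (auto simp: \<phi>_def)
  have \<psi>_lim: "(\<lambda>n. \<psi> n) \<longlonglongrightarrow> \<phi> j x"
    if "(\<lambda>n. exp (- \<psi> n)) \<longlonglongrightarrow> g j x" "g j x \<noteq> 0" for \<psi> :: "nat \<Rightarrow> real" and j x
    using tendsto_minus[OF tendsto_ln[OF that]] by (simp add: \<phi>_def)
  have \<Lambda>_lim: "(\<lambda>n. ennreal (\<psi> n)) \<longlonglongrightarrow> \<Lambda> j x"
    if l: "(\<lambda>n. exp (- \<psi> n)) \<longlonglongrightarrow> g j x" for \<psi> :: "nat \<Rightarrow> real" and j x
  proof (cases "g j x = 0")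
    case True
    then have "filterlim (\<lambda>n. exp (- \<psi> n)) (at_right 0) sequentially"
      using l by (simp add: filterlim_at)
    then have "filterlim (\<lambda>n. ln (exp (- \<psi> n))) at_bot sequentially"
      by (rule filterlim_compose[OF ln_at_0])
    then have "filterlim \<psi> at_top sequentially"
      by (simp add: filterlim_uminus_at_top)
    then show ?thesis
      using True by (simp add: \<Lambda>_def ennreal_tendsto_top_eq_at_top)
  next
    case False
    then show ?thesis using \<psi>_lim[OF l] by (simp add: \<Lambda>_def \<phi>_def tendsto_ennrealI)
  qed
  have \<Lambda>_meas: "\<Lambda> j \<in> borel_measurable M" if "j \<in> J" for j
    unfolding \<Lambda>_def[abs_def] using g_meas[OF that] by measurable
  have \<Lambda>_int: "(\<integral>\<^sup>+x. ennreal (u j k x) * \<Lambda> j x \<partial>M) \<le> ennreal A" if "j \<in> J" "k \<in> K j" for j k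
  proof -
    have "(\<integral>\<^sup>+x. ennreal (u j k x) * \<Lambda> j x \<partial>M) \<le> ennreal (A + 1 / Suc n)" for n
    proof -
      have "(j, k, n) \<in> Q" using that by (simp add: Q_def)
      then obtain \<psi> where \<psi>: "\<And>i::nat. \<psi> i \<in> X \<inter> D (j, k, n)"
        and lim: "AE x in M. \<forall>j\<in>J. (\<lambda>i. exp (- \<psi> i j x)) \<longlonglongrightarrow> g j x"
        using g_lim[of "(j, k, n)"] by (auto simp: AE_N)
      have \<psi>_meas: "\<psi> i j \<in> borel_measurable M" for i
        using \<psi>[of i] that(1) by (simp add: X_def)
      have "(\<integral>\<^sup>+x. ennreal (u j k x) * \<Lambda> j x \<partial>M)
          = (\<integral>\<^sup>+x. liminf (\<lambda>i. ennreal (u j k x * \<psi> i j x)) \<partial>M)"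
      proof (intro nn_integral_cong_AE, use lim AE_space in eventually_elim)
        case (elim x)
        have "(\<lambda>i. ennreal (u j k x) * ennreal (\<psi> i j x)) \<longlonglongrightarrow> ennreal (u j k x) * \<Lambda> j x"
          using elim that by (intro ennreal_tendsto_cmult \<Lambda>_lim) auto
        then show ?case
          using nonneg[OF that elim(2)] by (simp add: lim_imp_Liminf ennreal_mult')
      qed
      also have "\<dots> \<le> liminf (\<lambda>i. \<integral>\<^sup>+x. ennreal (u j k x * \<psi> i j x) \<partial>M)"
        using meas[OF that] \<psi>_meas by (intro nn_integral_liminf) simp
      also have "\<dots> \<le> ennreal (A + 1 / Suc n)"
        using \<psi> by (intro Liminf_le) (auto simp: D_def simp del: ennreal_plus)
      finally show ?thesis .
    qed
    moreover have "(\<lambda>n. ennreal (A + 1 / Suc n)) \<longlonglongrightarrow> ennreal (A + 0)"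
      using LIMSEQ_inverse_real_of_nat unfolding inverse_eq_divide
      by (intro tendsto_ennrealI tendsto_add tendsto_const)
    ultimately show ?thesis by (auto intro: LIMSEQ_le_const)
  qed
  have g_ne: "AE x in M. g j x \<noteq> 0" if j: "j \<in> J" for j
  proof -
    define E where "E = {x \<in> space M. g j x = 0}"
    have E: "E \<in> sets M" unfolding E_def using g_meas[OF j] by measurable
    have "AE x in M. x \<in> E \<longrightarrow> u j k x = 0" if k: "k \<in> K j" for k
    proof -
      have "AE x in M. ennreal (u j k x) * \<Lambda> j x \<noteq> \<infinity>"
        using \<Lambda>_int[OF j k] meas[OF j k] \<Lambda>_meas[OF j]
        by (intro nn_integral_PInf_AE) (auto simp: top_unique)
      then show ?thesis
        using AE_space
        by eventually_elim
          (use nonneg[OF j k] in \<open>force simp: E_def \<Lambda>_def ennreal_mult_top split: if_splits\<close>)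
    qed
    then have "emeasure M E = 0"
      using sat[OF j] E unfolding saturating_def by blast
    then have "AE x in M. x \<notin> E" using E by (intro AE_not_in null_setsI)
    then show ?thesis using AE_space by eventually_elim (simp add: E_def)
  qed
  have "\<phi> j \<in> borel_measurable M" if "j \<in> J" for j
    unfolding \<phi>_def[abs_def] using g_meas[OF that] by measurable
  moreover have "(\<integral>\<^sup>+x. ennreal (u j k x * \<phi> j x) \<partial>M) \<le> ennreal A" if "j \<in> J" "k \<in> K j" for j k
  proof -
    have "(\<integral>\<^sup>+x. ennreal (u j k x * \<phi> j x) \<partial>M) = (\<integral>\<^sup>+x. ennreal (u j k x) * \<Lambda> j x \<partial>M)"
      by (intro nn_integral_cong_AE, use g_ne[OF that(1)] AE_space in eventually_elim)
        (use nonneg[OF that] in \<open>simp add: \<Lambda>_def ennreal_mult' flip: \<phi>_def\<close>)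
    then show ?thesis using \<Lambda>_int[OF that] by simp
  qed
  moreover have "AE x in M. 1 \<le> gm (\<lambda>j. \<phi> j x)"
  proof -
    \<comment> \<open>The bound below does not involve the constraints, so the sequence for any one of them will do.\<close>
    obtain j k where "j \<in> J" "k \<in> K j" using J_nonempty K_ne by blast
    then have "(j, k, 0) \<in> Q" by (simp add: Q_def)
    then obtain \<psi> where \<psi>: "\<And>i::nat. \<psi> i \<in> X"
      and lim: "AE x in M. \<forall>j\<in>J. (\<lambda>i. exp (- \<psi> i j x)) \<longlonglongrightarrow> g j x"
      using g_lim[of "(j, k, 0)"] by (auto simp: AE_N)
    have "AE x in M. \<forall>j\<in>J. g j x \<noteq> 0"
      using finite_J g_ne by (intro AE_finite_allI) auto
    with lim show ?thesis
      using AE_space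
    proof eventually_elim
      case (elim x)
      have "(\<lambda>i. gm (\<lambda>j. \<psi> i j x)) \<longlonglongrightarrow> gm (\<lambda>j. \<phi> j x)"
        using elim \<psi> by (intro tendsto_gm \<psi>_lim) (auto simp: X_def)
      then show ?case
        using \<psi> elim(3) by (intro LIMSEQ_le_const) (auto simp: X_def)
    qed
  qed
  ultimately show ?thesis using \<phi>_nonneg by blast
qed

end

theorem theorem1p4:
  fixes M :: "'a measure"
    and d :: nat
    and \<theta> :: "nat \<Rightarrow> real"
    and K :: "nat \<Rightarrow> 'k set"
    and u :: "nat \<Rightarrow> 'k \<Rightarrow> 'a \<Rightarrow> real"
    and A :: real
  assumes "sigma_finite_measure M"
    and "\<And>j. j \<in> {1..d} \<Longrightarrow> 0 < \<theta> j \<and> \<theta> j < 1"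
    and "(\<Sum>j=1..d. \<theta> j) = 1"
    and "\<And>j. j \<in> {1..d} \<Longrightarrow> saturating M (u j ` K j)"
    and "\<And>j k x. j \<in> {1..d} \<Longrightarrow> k \<in> K j \<Longrightarrow> x \<in> space M \<Longrightarrow> 0 \<le> u j k x"
    and "0 \<le> A"
    and "\<And>\<alpha> :: nat \<Rightarrow> 'k \<Rightarrow> real.
           (\<And>j. j \<in> {1..d} \<Longrightarrow> finite {k \<in> K j. \<alpha> j k \<noteq> 0}) \<Longrightarrow>
           (\<integral>\<^sup>+ x. ennreal (\<Prod>j=1..d.
               \<bar>\<Sum>k\<in>{k \<in> K j. \<alpha> j k \<noteq> 0}. \<alpha> j k * u j k x\<bar> powr \<theta> j) \<partial>M)
             \<le> ennreal (A * (\<Prod>j=1..d. (\<Sum>k\<in>{k \<in> K j. \<alpha> j k \<noteq> 0}. \<bar>\<alpha> j k\<bar>) powr \<theta> j))"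
  shows "\<exists>\<phi> :: nat \<Rightarrow> 'a \<Rightarrow> real.
           (\<forall>j\<in>{1..d}. \<phi> j \<in> borel_measurable M \<and> (\<forall>x\<in>space M. 0 \<le> \<phi> j x)) \<and>
           (AE x in M. 1 \<le> (\<Prod>j=1..d. \<phi> j x powr \<theta> j)) \<and>
           (\<forall>j\<in>{1..d}. \<forall>k\<in>K j. (\<integral>\<^sup>+ x. ennreal (u j k x * \<phi> j x) \<partial>M) \<le> ennreal A)"
proof -
  interpret geometric_weights "{1..d}" \<theta>
  proof
    show "0 < \<theta> j" if "j \<in> {1..d}" for j using assms(2)[OF that] by simp
  qed (use assms(3) in simp_all)
  have bound: "(\<integral>\<^sup>+x. ennreal (gm (\<lambda>j. \<Sum>k\<in>F j. \<beta> j k * u j k x)) \<partial>M) \<le> ennreal A"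
    if F: "\<And>j. j \<in> {1..d} \<Longrightarrow> finite (F j) \<and> F j \<subseteq> K j" and \<beta>: "\<beta> \<in> weight_systems F" for F \<beta>
  proof -
    \<comment> \<open>The hypothesis sums over the support of a family of coefficients, which may be smaller than \<open>F j\<close>.\<close>
    define \<alpha> where "\<alpha> j k = (if k \<in> F j then \<beta> j k else 0)" for j k
    define S where "S j = {k \<in> K j. \<alpha> j k \<noteq> 0}" for j
    have sub: "S j \<subseteq> F j" for j by (auto simp: S_def \<alpha>_def)
    have fin: "finite (S j)" if "j \<in> {1..d}" for j
      using F[OF that] sub finite_subset by blast
    have sum_S: "(\<Sum>k\<in>S j. f (\<alpha> j k) k) = (\<Sum>k\<in>F j. f (\<beta> j k) k)"
      if "j \<in> {1..d}" "\<And>k. f 0 k = 0" for f :: "real \<Rightarrow> 'k \<Rightarrow> real" and j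
      using F[OF that(1)] sub that(2)
      by (intro sum.mono_neutral_cong_left) (auto simp: S_def \<alpha>_def)
    have nonneg: "0 \<le> \<beta> j k" if "j \<in> {1..d}" "k \<in> F j" for j k
      using \<beta> that unfolding weight_systems_def by blast
    have "(\<Sum>k\<in>S j. \<bar>\<alpha> j k\<bar>) = 1" if j: "j \<in> {1..d}" for j
    proof -
      have "(\<Sum>k\<in>S j. \<bar>\<alpha> j k\<bar>) = (\<Sum>k\<in>F j. \<bar>\<beta> j k\<bar>)"
        using sum_S[OF j, of "\<lambda>a k. \<bar>a\<bar>"] by simp
      also have "\<dots> = (\<Sum>k\<in>F j. \<beta> j k)" using nonneg[OF j] by (intro sum.cong) auto
      also have "\<dots> = 1" using \<beta> j unfolding weight_systems_def by blast
      finally show ?thesis .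
    qed
    moreover have "\<bar>\<Sum>k\<in>S j. \<alpha> j k * u j k x\<bar> = (\<Sum>k\<in>F j. \<beta> j k * u j k x)"
      if "j \<in> {1..d}" "x \<in> space M" for j x
    proof -
      have "0 \<le> (\<Sum>k\<in>F j. \<beta> j k * u j k x)"
        using nonneg assms(5) F that by (intro sum_nonneg mult_nonneg_nonneg) blast+
      then show ?thesis using sum_S[OF that(1), of "\<lambda>a k. a * u j k x"] by simp
    qed
    ultimately show ?thesis
      using assms(7)[of \<alpha>] fin unfolding S_def[symmetric] gm_def
      by (simp cong: nn_integral_cong)
  qed
  show ?thesis
    using factorisation_of_saturating_families[OF assms(1,4,5,6) bound] unfolding gm_def .
qed

end
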